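(* Let $X$ be a complex manifold with $\dim_{\mathbb{C}}X=n$. (i) For any $\xi\in C^\infty(X,T^{1,0}X)$, if $\xi=\sum_{k=1}^n\xi_k\frac{\partial}{\partial z_k}$ is its expression in local holomorphic coordinates $(z_1,\dots,z_n)$, then for any bidegree $(p,q)$ and any form $u\in C^\infty_{p,q}(X,\mathbb{C})$: $$L^{1,0}_\xi u=\sum_{k=1}^n\partial\xi_k\wedge\Big(\frac{\partial}{\partial z_k}\lrcorner u\Big)+\sum_{k=1}^n\xi_k\frac{\partial u}{\partial z_k}=(\partial\xi)\lrcorner u+\xi(u),$$ where $\partial\xi:=\sum_{k=1}^n\partial\xi_k\wedge\frac{\partial}{\partial z_k}$ is a locally defined $(1,0)$-form with values in $T^{1,0}X$, while $\xi(\cdot):=\sum_{k=1}^n\xi_k\frac{\partial(\cdot)}{\partial z_k}$ is a locally defined first-order differential operator acting on differential forms. In particular, $L^{1,0}_{\partial/\partial z_k}u=\frac{\partial u}{\partial z_k}$ for $k=1,\dots,n$. (ii) For any $\theta\in C^\infty_{0,1}(X,T^{1,0}X)$, if $\theta=\sum_{k,r=1}^n\theta^k_{\bar r}\,d\bar z_r\wedge\frac{\partial}{\partial z_k}$ is its expression in local holomorphic coordinates $(z_1,\dots,z_n)$, then for any bidegree $(p,q)$ and any form $u\in C^\infty_{p,q}(X,\mathbb{C})$: $$L_\theta u=\sum_{k,r=1}^n\partial\theta^k_{\bar r}\wedge d\bar z_r\wedge\Big(\frac{\partial}{\partial z_k}\lrcorner u\Big)-\sum_{k,r=1}^n\theta^k_{\bar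 r}\,d\bar z_r\wedge\frac{\partial u}{\partial z_k}=(\partial\theta)\lrcorner u-\theta(u),$$ where $\partial\theta:=\sum_{k,r=1}^n\partial\theta^k_{\bar r}\wedge d\bar z_r\wedge\frac{\partial}{\partial z_k}$ is a locally defined $(1,1)$-form with values in $T^{1,0}X$, while $\theta(\cdot):=\sum_{k,r=1}^n\theta^k_{\bar r}\,d\bar z_r\wedge\frac{\partial(\cdot)}{\partial z_k}$ is a locally defined first-order differential operator acting on differential forms.
   Context: $C^\infty_{p,q}(X,\mathbb{C})$ denotes smooth $(p,q)$-forms and $C^\infty_{0,s}(X,T^{1,0}X)$ smooth $(0,s)$-forms with values in the holomorphic tangent bundle ($C^\infty(X,T^{1,0}X)$ when $s=0$). For a $T^{1,0}X$-valued form written locally $\sum_k\alpha^k\wedge\frac{\partial}{\partial z_k}$ with scalar forms $\alpha^k$, contraction is $\big(\sum_k\alpha^k\wedge\frac{\partial}{\partial z_k}\big)\lrcorner u:=\sum_k\alpha^k\wedge\big(\frac{\partial}{\partial z_k}\lrcorner u\big)$. For $\xi\in C^\infty(X,T^{1,0}X)$, $L^{1,0}_\xi u:=\partial(\xi\lrcorner u)+\xi\lrcorner\partial u$. For $\theta\in C^\infty_{0,1}(X,T^{1,0}X)$, the Lie derivative $L_\theta:C^\infty_{p,q}(X,\mathbb{C})\to C^\infty_{p,q+1}(X,\mathbb{C})$ is $L_\theta u:=\partial(\theta\lrcorner u)-\theta\lrcorner\partial u$. If locally $u=\sum_{|I|=p,|J|=q}u_{I\bar J}\,dz_I\wedge d\bar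 z_J$, then $\frac{\partial u}{\partial z_k}:=\sum_{|I|=p,|J|=q}\frac{\partial u_{I\bar J}}{\partial z_k}\,dz_I\wedge d\bar z_J$. *)

theory Defs
  imports "HOL-Analysis.Analysis"
begin

type_synonym 'n cvec = "(complex, 'n) vec"


section \<open>The exterior algebra on $dz_1, \dots, dz_n, d\bar z_1, \dots, d\bar z_n$\<close>

text \<open>The coordinate indices $1, \dots, n$ are the elements of a finite linearly ordered type.
  A form at a point is the family of its coefficients $u_{I\bar J}$ with respect to the basis
  $dz_I \wedge d\bar z_J$, where the factors of $dz_I$ and $d\bar z_J$ are taken in increasing
  order. All degrees are allowed at once; bidegree is a condition on the coefficients.\<close>

type_synonym 'n form = "(complex, 'n set \<times> 'n set) vec"

text \<open>Sign of the permutation that sorts the concatenation of the increasing enumerations of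
  two disjoint sets: $dz_I \wedge dz_K = \pm dz_{I \cup K}$.\<close>

definition shuffle_sign :: "'n::{finite,linorder} set \<Rightarrow> 'n set \<Rightarrow> complex" where
  "shuffle_sign I K = (- 1) ^ card {(i, k). i \<in> I \<and> k \<in> K \<and> k < i}"

text \<open>The extra sign comes from moving $dz_{I'}$ past $d\bar z_J$ in
  $dz_I \wedge d\bar z_J \wedge dz_{I'} \wedge d\bar z_{J'}$.\<close>

definition wedge :: "'n::{finite,linorder} form \<Rightarrow> 'n form \<Rightarrow> 'n form"
    (infixr "\<and>\<^sub>w" 75) where
  "\<alpha> \<and>\<^sub>w \<beta> = (\<chi> KL. \<Sum>I\<in>Pow (fst KL). \<Sum>J\<in>Pow (snd KL).
     (- 1) ^ (card J * card (fst KL - I)) * shuffle_sign I (fst KL - I) * shuffle_sign J (snd KL - J)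
     * \<alpha> $ (I, J) * \<beta> $ (fst KL - I, snd KL - J))"

definition dzI_dzbJ :: "'n::{finite,linorder} set \<Rightarrow> 'n set \<Rightarrow> 'n form" where
  "dzI_dzbJ I J = axis (I, J) 1"

definition scalar_form :: "complex \<Rightarrow> 'n::{finite,linorder} form" where
  "scalar_form a = a *s dzI_dzbJ {} {}"

definition dz :: "'n::{finite,linorder} \<Rightarrow> 'n form" where
  "dz k = dzI_dzbJ {k} {}"

definition dzb :: "'n::{finite,linorder} \<Rightarrow> 'n form" where
  "dzb k = dzI_dzbJ {} {k}"

text \<open>Contraction with $\partial/\partial z_k$: $dz_k \wedge dz_I \wedge d\bar z_J$ is sent to
  $dz_I \wedge d\bar z_J$ if $k \notin I$, and every $dz_I \wedge d\bar z_J$ with $k \notin I$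
  is sent to $0$.\<close>

definition contr :: "'n::{finite,linorder} \<Rightarrow> 'n form \<Rightarrow> 'n form" where
  "contr k u = (\<chi> IJ. if k \<in> fst IJ then 0
     else shuffle_sign {k} (fst IJ) * u $ (insert k (fst IJ), snd IJ))"

text \<open>A form $\sum_k \alpha^k \wedge \partial/\partial z_k$ with values in $T^{1,0}$ at a point is
  the vector of its scalar components $\alpha^k$.\<close>

type_synonym 'n tform = "('n form, 'n) vec"

definition tensor_ddz :: "'n::{finite,linorder} form \<Rightarrow> 'n \<Rightarrow> 'n tform" where
  "tensor_ddz \<alpha> k = axis k \<alpha>"

definition contraction :: "'n::{finite,linorder} tform \<Rightarrow> 'n form \<Rightarrow> 'n form" where
  "contraction \<alpha> u = (\<Sum>k\<in>UNIV. (\<alpha> $ k) \<and>\<^sub>w contr k u)"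


section \<open>Calculus on open subsets of $\mathbb{C}^n$\<close>

text \<open>Smoothness is in the real sense; holomorphy in several variables is complex Frechet
  differentiability. Both are used for open sets only.\<close>

fun Ck_on :: "nat \<Rightarrow> 'a::real_normed_vector set \<Rightarrow> ('a \<Rightarrow> 'b::real_normed_vector) \<Rightarrow> bool" where
  "Ck_on 0 S f \<longleftrightarrow> continuous_on S f"
| "Ck_on (Suc m) S f \<longleftrightarrow> (\<forall>z\<in>S. f differentiable (at z)) \<and>
     (\<forall>v. Ck_on m S (\<lambda>z. frechet_derivative f (at z) v))"

definition smooth_on :: "'a::real_normed_vector set \<Rightarrow> ('a \<Rightarrow> 'b::real_normed_vector) \<Rightarrow> bool" where
  "smooth_on S f \<longleftrightarrow> (\<forall>m. Ck_on m S f)"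

definition holomorphic_map_on :: "'n::finite cvec set \<Rightarrow> ('n cvec \<Rightarrow> 'm::finite cvec) \<Rightarrow> bool" where
  "holomorphic_map_on S f \<longleftrightarrow>
     (\<forall>z\<in>S. \<exists>D. (f has_derivative D) (at z) \<and> (\<forall>a v. D (a *s v) = a *s D v))"

text \<open>$\partial f/\partial z_k = \frac12 (\partial f/\partial x_k - i\, \partial f/\partial y_k)$,
  where $z_k = x_k + i y_k$.\<close>

definition ddz :: "'n::finite \<Rightarrow> ('n cvec \<Rightarrow> complex) \<Rightarrow> 'n cvec \<Rightarrow> complex" where
  "ddz k f z = (frechet_derivative f (at z) (axis k 1)
     - \<i> * frechet_derivative f (at z) (axis k \<i>)) / 2"

definition ddz_form :: "'n::{finite,linorder} \<Rightarrow> ('n cvec \<Rightarrow> 'n form) \<Rightarrow> 'n cvec \<Rightarrow> 'n form" where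
  "ddz_form k u z = (\<Sum>I\<in>UNIV. \<Sum>J\<in>UNIV. ddz k (\<lambda>w. u w $ (I, J)) z *s dzI_dzbJ I J)"

definition del_fun :: "('n cvec \<Rightarrow> complex) \<Rightarrow> 'n cvec \<Rightarrow> 'n::{finite,linorder} form" where
  "del_fun f z = (\<Sum>k\<in>UNIV. ddz k f z *s dz k)"

definition del :: "('n cvec \<Rightarrow> 'n form) \<Rightarrow> 'n cvec \<Rightarrow> 'n::{finite,linorder} form" where
  "del u z = (\<Sum>I\<in>UNIV. \<Sum>J\<in>UNIV. del_fun (\<lambda>w. u w $ (I, J)) z \<and>\<^sub>w dzI_dzbJ I J)"


section \<open>Pull-back by a holomorphic map\<close>

text \<open>If $z' = \psi(z)$ with $\psi$ holomorphic, then
  $dz'_k = \sum_j (\partial\psi_k/\partial z_j)\, dz_j$ and $d\bar z'_k$ is its conjugate;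
  these are substituted into $\sum u_{I\bar J}\, dz'_I \wedge d\bar z'_J$.\<close>

definition pull_dz :: "('n cvec \<Rightarrow> 'n cvec) \<Rightarrow> 'n cvec \<Rightarrow> 'n \<Rightarrow> 'n::{finite,linorder} form" where
  "pull_dz \<psi> z k = (\<Sum>j\<in>UNIV. ddz j (\<lambda>w. \<psi> w $ k) z *s dz j)"

definition pull_dzb :: "('n cvec \<Rightarrow> 'n cvec) \<Rightarrow> 'n cvec \<Rightarrow> 'n \<Rightarrow> 'n::{finite,linorder} form" where
  "pull_dzb \<psi> z k = (\<Sum>j\<in>UNIV. cnj (ddz j (\<lambda>w. \<psi> w $ k) z) *s dzb j)"

definition pull_dzI_dzbJ ::
    "('n cvec \<Rightarrow> 'n cvec) \<Rightarrow> 'n cvec \<Rightarrow> 'n set \<Rightarrow> 'n set \<Rightarrow> 'n::{finite,linorder} form" where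
  "pull_dzI_dzbJ \<psi> z I J = foldr (\<and>\<^sub>w)
     (map (pull_dz \<psi> z) (sorted_list_of_set I) @ map (pull_dzb \<psi> z) (sorted_list_of_set J))
     (scalar_form 1)"

definition pullback ::
    "('n cvec \<Rightarrow> 'n cvec) \<Rightarrow> 'n cvec \<Rightarrow> 'n form \<Rightarrow> 'n::{finite,linorder} form" where
  "pullback \<psi> z \<eta> = (\<Sum>I\<in>UNIV. \<Sum>J\<in>UNIV. \<eta> $ (I, J) *s pull_dzI_dzbJ \<psi> z I J)"


section \<open>Complex manifolds\<close>

text \<open>A chart is a pair of its domain and its coordinate map; the values of the coordinate map
  outside the domain are irrelevant.\<close>

type_synonym ('a, 'n) chart = "'a set \<times> ('a \<Rightarrow> 'n cvec)"

definition coord_range :: "('a, 'n::finite) chart \<Rightarrow> 'n cvec set" where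
  "coord_range c = snd c ` fst c"

definition is_chart :: "'a topology \<Rightarrow> ('a, 'n::finite) chart \<Rightarrow> bool" where
  "is_chart X c \<longleftrightarrow> openin X (fst c) \<and> open (coord_range c) \<and>
     homeomorphic_map (subtopology X (fst c)) (top_of_set (coord_range c)) (snd c)"

definition transition :: "('a, 'n::finite) chart \<Rightarrow> ('a, 'n) chart \<Rightarrow> 'n cvec \<Rightarrow> 'n cvec" where
  "transition c c' = snd c' \<circ> inv_into (fst c) (snd c)"

definition hol_compatible :: "('a, 'n::finite) chart \<Rightarrow> ('a, 'n) chart \<Rightarrow> bool" where
  "hol_compatible c c' \<longleftrightarrow>
     holomorphic_map_on (snd c ` (fst c \<inter> fst c')) (transition c c') \<and>
     holomorphic_map_on (snd c' ` (fst c \<inter> fst c')) (transition c' c)"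

text \<open>The complex structure is a maximal holomorphic atlas, so that its charts are exactly the
  local holomorphic coordinate systems of the manifold.\<close>

definition complex_manifold :: "'a topology \<Rightarrow> ('a, 'n::finite) chart set \<Rightarrow> bool" where
  "complex_manifold X A \<longleftrightarrow>
     Hausdorff_space X \<and> second_countable X \<and>
     (\<forall>c\<in>A. is_chart X c) \<and> (\<Union>c\<in>A. fst c) = topspace X \<and>
     (\<forall>c\<in>A. \<forall>c'\<in>A. hol_compatible c c') \<and>
     (\<forall>c. is_chart X c \<and> (\<forall>c'\<in>A. hol_compatible c c') \<longrightarrow> c \<in> A)"


section \<open>Smooth forms\<close>

text \<open>A form on a manifold is given by its coordinate expressions: u c z is the expression
  of the form in the chart c, as a function of the coordinates z. The expressions in
  two charts are related by pull-back along the coordinate change. Values for charts outside the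
  atlas or for z outside the range of c are irrelevant.\<close>

definition pq_forms ::
    "('a, 'n) chart set \<Rightarrow> nat \<Rightarrow> nat \<Rightarrow> (('a, 'n) chart \<Rightarrow> 'n cvec \<Rightarrow> 'n::{finite,linorder} form) set"
  where
  "pq_forms A p q = {u.
     (\<forall>c\<in>A. \<forall>I J. smooth_on (coord_range c) (\<lambda>z. u c z $ (I, J))) \<and>
     (\<forall>c\<in>A. \<forall>z\<in>coord_range c. \<forall>I J. u c z $ (I, J) \<noteq> 0 \<longrightarrow> card I = p \<and> card J = q) \<and>
     (\<forall>c\<in>A. \<forall>c'\<in>A. \<forall>x\<in>fst c \<inter> fst c'.
        u c (snd c x) = pullback (transition c c') (snd c x) (u c' (snd c' x)))}"

text \<open>For $T^{1,0}X$-valued $(0,s)$-forms the components also transform by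
  $\partial/\partial z_j = \sum_k (\partial z'_k/\partial z_j)\, \partial/\partial z'_k$. For $s = 0$
  these are the smooth sections of $T^{1,0}X$.\<close>

definition t_forms ::
    "('a, 'n) chart set \<Rightarrow> nat \<Rightarrow> (('a, 'n) chart \<Rightarrow> 'n cvec \<Rightarrow> 'n::{finite,linorder} tform) set"
  where
  "t_forms A s = {\<alpha>.
     (\<forall>c\<in>A. \<forall>k I J. smooth_on (coord_range c) (\<lambda>z. \<alpha> c z $ k $ (I, J))) \<and>
     (\<forall>c\<in>A. \<forall>z\<in>coord_range c. \<forall>k I J. \<alpha> c z $ k $ (I, J) \<noteq> 0 \<longrightarrow> card I = 0 \<and> card J = s) \<and>
     (\<forall>c\<in>A. \<forall>c'\<in>A. \<forall>x\<in>fst c \<inter> fst c'. \<forall>k.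
        (\<Sum>j\<in>UNIV. ddz j (\<lambda>w. transition c c' w $ k) (snd c x) *s (\<alpha> c (snd c x) $ j))
        = pullback (transition c c') (snd c x) (\<alpha> c' (snd c' x) $ k))}"

text \<open>The field $\partial/\partial z_k$ of the chart c, a section of $T^{1,0}X$ over the domain of
  c, expressed in an arbitrary chart c'.\<close>

definition coord_field ::
    "('a, 'n) chart \<Rightarrow> 'n \<Rightarrow> ('a, 'n) chart \<Rightarrow> 'n cvec \<Rightarrow> 'n::{finite,linorder} tform" where
  "coord_field c k c' z' = (\<Sum>j\<in>UNIV. tensor_ddz
     (scalar_form (ddz k (\<lambda>w. transition c c' w $ j) (transition c' c z'))) j)"


section \<open>Lie derivatives\<close>

definition del_X ::
    "(('a, 'n) chart \<Rightarrow> 'n cvec \<Rightarrow> 'n form) \<Rightarrow>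
     ('a, 'n) chart \<Rightarrow> 'n cvec \<Rightarrow> 'n::{finite,linorder} form" where
  "del_X u = (\<lambda>c. del (u c))"

definition contraction_X ::
    "(('a, 'n) chart \<Rightarrow> 'n cvec \<Rightarrow> 'n tform) \<Rightarrow> (('a, 'n) chart \<Rightarrow> 'n cvec \<Rightarrow> 'n form) \<Rightarrow>
     ('a, 'n) chart \<Rightarrow> 'n cvec \<Rightarrow> 'n::{finite,linorder} form" where
  "contraction_X \<alpha> u = (\<lambda>c z. contraction (\<alpha> c z) (u c z))"

definition Lie10 ::
    "(('a, 'n) chart \<Rightarrow> 'n cvec \<Rightarrow> 'n tform) \<Rightarrow> (('a, 'n) chart \<Rightarrow> 'n cvec \<Rightarrow> 'n form) \<Rightarrow>
     ('a, 'n) chart \<Rightarrow> 'n cvec \<Rightarrow> 'n::{finite,linorder} form" where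
  "Lie10 \<xi> u c z = del_X (contraction_X \<xi> u) c z + contraction_X \<xi> (del_X u) c z"

definition Lie01 ::
    "(('a, 'n) chart \<Rightarrow> 'n cvec \<Rightarrow> 'n tform) \<Rightarrow> (('a, 'n) chart \<Rightarrow> 'n cvec \<Rightarrow> 'n form) \<Rightarrow>
     ('a, 'n) chart \<Rightarrow> 'n cvec \<Rightarrow> 'n::{finite,linorder} form" where
  "Lie01 \<theta> u c z = del_X (contraction_X \<theta> u) c z - contraction_X \<theta> (del_X u) c z"


section \<open>The local operators\<close>

text \<open>Here $\xi = \sum_k f_k\, \partial/\partial z_k$ and
  $\theta = \sum_{k,r} g^k_{\bar r}\, d\bar z_r \wedge \partial/\partial z_k$ in fixed local
  coordinates. These operators depend on the chart.\<close>

definition del_vec :: "('n \<Rightarrow> 'n cvec \<Rightarrow> complex) \<Rightarrow> 'n cvec \<Rightarrow> 'n::{finite,linorder} tform" where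
  "del_vec f z = (\<Sum>k\<in>UNIV. tensor_ddz (del_fun (f k) z) k)"

definition act_vec ::
    "('n \<Rightarrow> 'n cvec \<Rightarrow> complex) \<Rightarrow> ('n cvec \<Rightarrow> 'n form) \<Rightarrow> 'n cvec \<Rightarrow> 'n::{finite,linorder} form" where
  "act_vec f u z = (\<Sum>k\<in>UNIV. f k z *s ddz_form k u z)"

definition del_t01 :: "('n \<Rightarrow> 'n \<Rightarrow> 'n cvec \<Rightarrow> complex) \<Rightarrow> 'n cvec \<Rightarrow> 'n::{finite,linorder} tform" where
  "del_t01 g z = (\<Sum>k\<in>UNIV. \<Sum>r\<in>UNIV. tensor_ddz (del_fun (g k r) z \<and>\<^sub>w dzb r) k)"

definition act_t01 ::
    "('n \<Rightarrow> 'n \<Rightarrow> 'n cvec \<Rightarrow> complex) \<Rightarrow> ('n cvec \<Rightarrow> 'n form) \<Rightarrow> 'n cvec \<Rightarrow> 'n::{finite,linorder} form" where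
  "act_t01 g u z = (\<Sum>k\<in>UNIV. \<Sum>r\<in>UNIV. g k r z *s (dzb r \<and>\<^sub>w ddz_form k u z))"

end

theory Submission
  imports Defs
begin

text \<open>In a chart, $\partial u = \sum_j dz_j \wedge \partial u/\partial z_j$, and $\partial/\partial z_j$
  commutes with the constant-coefficient operators
  $T_k u = \frac{\partial}{\partial z_k} \lrcorner u$ and
  $T_{kr} u = d\bar z_r \wedge (\frac{\partial}{\partial z_k} \lrcorner u)$. The Leibniz rule therefore
  splits $\partial(\sum_k f_k T_k u)$ into the terms $\partial f_k \wedge T_k u$ and the terms
  $f_k\, dz_j \wedge T_k (\partial u/\partial z_j)$. The latter cancel against part of
  $f_k T_k (\partial u)$, because contraction is an antiderivation:
  $\frac{\partial}{\partial z_k} \lrcorner (dz_j \wedge v)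
    = \delta_{jk} v - dz_j \wedge (\frac{\partial}{\partial z_k} \lrcorner v)$. The Kronecker term leaves
  $f_k\, \partial u/\partial z_k$. For $T_{kr}$ the cancellation needs the other sign in the definition
  of $L_\theta$, since $d\bar z_r$ anticommutes with $dz_j$.\<close>

section \<open>Complex-linear maps on coordinate vectors\<close>

abbreviation clinear :: "((complex, 'a::finite) vec \<Rightarrow> (complex, 'b::finite) vec) \<Rightarrow> bool" where
  "clinear \<equiv> Vector_Spaces.linear (*s) (*s)"

lemma clinearI:
  fixes T :: "(complex, 'a::finite) vec \<Rightarrow> (complex, 'b::finite) vec"
  assumes "\<And>x y. T (x + y) = T x + T y" "\<And>c x. T (c *s x) = c *s T x"
  shows "clinear T"
  unfolding Vector_Spaces.linear_iff by (simp add: assms vec.vector_space_axioms)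

lemmas clinear_add = vec.linear_add
  and clinear_diff = vec.linear_diff
  and clinear_scale = vec.linear_scale
  and clinear_sum = vec.linear_sum

lemma scaleR_conv_smult:
  fixes x :: "(complex, 'a::finite) vec"
  shows "r *\<^sub>R x = of_real r *s x"
  by (simp add: vec_eq_iff) (simp add: scaleR_conv_of_real)

text \<open>Derivatives here are real Frechet derivatives, so a complex-linear operator passes
  through them only as a bounded real-linear map.\<close>

lemma clinear_imp_bounded_linear: "clinear T \<Longrightarrow> bounded_linear T"
  unfolding linear_conv_bounded_linear[symmetric]
  by (rule linearI) (simp_all add: clinear_add clinear_scale scaleR_conv_smult)

lemma bounded_bilinear_smult:
  "bounded_bilinear ((*s) :: complex \<Rightarrow> (complex, 'a::finite) vec \<Rightarrow> _)"
  unfolding bilinear_conv_bounded_bilinear[symmetric] bilinear_def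
  by (auto intro!: linearI simp: vec_eq_iff algebra_simps)

text \<open>Smoothness of forms is imposed coefficient by coefficient, while the Leibniz rule below
  differentiates the whole vector-valued \<open>u\<close>.\<close>

lemma differentiable_vec_componentwise:
  fixes u :: "'b::real_normed_vector \<Rightarrow> (complex, 'a::finite) vec"
  assumes "\<And>i. (\<lambda>w. u w $ i) differentiable (at z)"
  shows "u differentiable (at z)"
proof -
  have *: "bounded_linear (\<lambda>x. axis i x :: (complex, 'a) vec)" for i
    unfolding linear_conv_bounded_linear[symmetric]
    by (rule linearI) (auto simp: vec_eq_iff axis_def)
  have u: "u = (\<lambda>w. \<Sum>i\<in>UNIV. axis i (u w $ i))"
    by (auto simp: fun_eq_iff vec_eq_iff axis_def)
  have "(\<lambda>w. axis i (u w $ i)) differentiable (at z)" for i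
    using assms[of i] bounded_linear.has_derivative[OF *] unfolding differentiable_def by blast
  then show ?thesis
    by (subst u) (auto intro!: differentiable_sum)
qed


section \<open>The exterior algebra\<close>

lemma wedge_component:
  "(\<alpha> \<and>\<^sub>w \<beta>) $ (K, L) = (\<Sum>I\<in>Pow K. \<Sum>J\<in>Pow L.
     (- 1) ^ (card J * card (K - I)) * shuffle_sign I (K - I) * shuffle_sign J (L - J)
     * \<alpha> $ (I, J) * \<beta> $ (K - I, L - J))"
  by (simp add: wedge_def)

lemma clinear_wedge_left: "clinear (\<lambda>\<alpha>. \<alpha> \<and>\<^sub>w \<beta>)"
  by (rule clinearI)
    (auto simp: vec_eq_iff wedge_component sum.distrib sum_distrib_left algebra_simps)

lemma clinear_wedge_right: "clinear (\<lambda>\<beta>. \<alpha> \<and>\<^sub>w \<beta>)"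
  by (rule clinearI)
    (auto simp: vec_eq_iff wedge_component sum.distrib sum_distrib_left algebra_simps)

lemma clinear_contr: "clinear (contr k)"
  by (rule clinearI) (auto simp: vec_eq_iff contr_def algebra_simps)

lemma wedge_dzI_dzbJ_component:
  "(dzI_dzbJ I J \<and>\<^sub>w v) $ (K, L) =
     (if I \<subseteq> K \<and> J \<subseteq> L then
        (- 1) ^ (card J * card (K - I)) * shuffle_sign I (K - I) * shuffle_sign J (L - J)
        * v $ (K - I, L - J) else 0)"
proof -
  have "(dzI_dzbJ I J \<and>\<^sub>w v) $ (K, L) = (\<Sum>I'\<in>Pow K. \<Sum>J'\<in>Pow L. if I' = I \<and> J' = J then
        (- 1) ^ (card J * card (K - I)) * shuffle_sign I (K - I) * shuffle_sign J (L - J)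
        * v $ (K - I, L - J) else 0)"
    unfolding wedge_component
    by (intro sum.cong refl) (auto simp: dzI_dzbJ_def axis_def)
  \<comment> \<open>The conjunction is split into nested conditionals, so that each of the two sums
    becomes a delta sum.\<close>
  also have "\<dots> = (\<Sum>I'\<in>Pow K. if I' = I then \<Sum>J'\<in>Pow L. if J' = J then
        (- 1) ^ (card J * card (K - I)) * shuffle_sign I (K - I) * shuffle_sign J (L - J)
        * v $ (K - I, L - J) else 0 else 0)"
    by (intro sum.cong refl) (auto intro!: sum.neutral)
  finally show ?thesis
    by (auto simp: sum.delta)
qed

section \<open>Signs for a single covector\<close>

lemma shuffle_sign_empty [simp]: "shuffle_sign {} K = 1" "shuffle_sign I {} = 1"
  by (auto simp: shuffle_sign_def)

lemma shuffle_sign_singleton: "shuffle_sign {k} K = (- 1) ^ card {i\<in>K. i < k}"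
proof -
  have "{(i, l). i \<in> {k} \<and> l \<in> K \<and> l < i} = Pair k ` {i\<in>K. i < k}" by auto
  then show ?thesis
    unfolding shuffle_sign_def by (metis (no_types, lifting) card_image inj_on_def prod.inject)
qed

lemma shuffle_sign_singleton_square [simp]:
  "shuffle_sign {k} K * shuffle_sign {k} K = 1"
  "shuffle_sign {k} K * (shuffle_sign {k} K * a) = a"
  by (simp_all add: shuffle_sign_singleton flip: power_add mult.assoc)

text \<open>The new index creates one more inversion exactly when it lies below \<open>k\<close>.
  The minus sign of the antiderivation rule comes from here.\<close>

lemma shuffle_sign_singleton_insert:
  assumes "l \<notin> K"
  shows "shuffle_sign {k} (insert l K) = (if l < k then - 1 else 1) * shuffle_sign {k} K"
proof -
  have "{i \<in> insert l K. i < k} = (if l < k then insert l {i\<in>K. i < k} else {i\<in>K. i < k})"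
    by auto
  then show ?thesis using assms by (simp add: shuffle_sign_singleton)
qed

lemma wedge_dz_component:
  "(dz j \<and>\<^sub>w v) $ (K, L) =
     (if j \<in> K then shuffle_sign {j} (K - {j}) * v $ (K - {j}, L) else 0)"
  by (simp add: dz_def wedge_dzI_dzbJ_component)

lemma wedge_dzb_component:
  "(dzb r \<and>\<^sub>w v) $ (K, L) =
     (if r \<in> L then (- 1) ^ card K * shuffle_sign {r} (L - {r}) * v $ (K, L - {r}) else 0)"
  by (simp add: dzb_def wedge_dzI_dzbJ_component)

lemma wedge_scalar_form: "scalar_form a \<and>\<^sub>w v = a *s v"
proof -
  have "scalar_form 1 \<and>\<^sub>w v = v"
    by (auto simp: vec_eq_iff scalar_form_def wedge_dzI_dzbJ_component)
  moreover have "scalar_form a = a *s scalar_form 1"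
    by (simp add: scalar_form_def)
  ultimately show ?thesis
    by (metis clinear_scale[OF clinear_wedge_left])
qed

section \<open>Contraction and reordering of basis covectors\<close>

lemma contr_component:
  "contr k u $ (K, L) = (if k \<in> K then 0 else shuffle_sign {k} K * u $ (insert k K, L))"
  by (simp add: contr_def)

lemma contr_dz_wedge:
  "contr k (dz j \<and>\<^sub>w v) = (if j = k then v else 0) - dz j \<and>\<^sub>w contr k v"
proof -
  have "contr k (dz j \<and>\<^sub>w v) $ (K, L)
      = (if j = k then v $ (K, L) else 0) - (dz j \<and>\<^sub>w contr k v) $ (K, L)" for K L
  \<comment> \<open>If \<open>k \<in> K\<close>, the contraction on the left vanishes. On the right,
    \<open>j = k\<close> gives two equal terms because the sign squares to 1, and
    \<open>j \<noteq> k\<close> leaves a contraction at an index set that still contains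
    \<open>k\<close>.\<close>
  proof (cases "k \<in> K")
    case True
    then have "insert k (K - {k}) = K" by blast
    with True show ?thesis
      by (simp add: contr_component wedge_dz_component del: insert_Diff_single)
  next
    case k: False
    show ?thesis
    proof (cases "j \<in> K")
      case True
      with k have "j \<noteq> k" and 1: "insert k K - {j} = insert k (K - {j})"
        and 2: "insert j (K - {j}) = K"
        by auto
      have 3: "shuffle_sign {k} K = (if j < k then - 1 else 1) * shuffle_sign {k} (K - {j})"
        using shuffle_sign_singleton_insert[of j "K - {j}" k] unfolding 2 by simp
      have 4: "shuffle_sign {j} (insert k (K - {j}))
          = (if k < j then - 1 else 1) * shuffle_sign {j} (K - {j})"
        using k by (intro shuffle_sign_singleton_insert) simp
      show ?thesis
        \<comment> \<open>Exactly one of \<open>j < k\<close> and \<open>k < j\<close> holds, so the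
          equations 3 and 4 together contribute exactly one factor -1.\<close>
        using True k \<open>j \<noteq> k\<close> unfolding contr_component wedge_dz_component 1 3 4
        by auto
    next
      case False
      with k show ?thesis
        by (cases "j = k") (simp_all add: contr_component wedge_dz_component)
    qed
  qed
  then show ?thesis by (simp add: vec_eq_iff)
qed

lemma dz_wedge_dzb: "dz j \<and>\<^sub>w dzb r = dzI_dzbJ {j} {r}"
  by (auto simp: vec_eq_iff wedge_dz_component dzb_def dzI_dzbJ_def axis_def)

text \<open>The one instance of associativity needed for contraction with \<open>del_t01\<close>.
  The left bracket is a single basis element, so both sides can be compared by components.\<close>

lemma dz_wedge_dzb_wedge: "(dz j \<and>\<^sub>w dzb r) \<and>\<^sub>w v = dz j \<and>\<^sub>w dzb r \<and>\<^sub>w v"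
  by (auto simp: vec_eq_iff dz_wedge_dzb wedge_dzI_dzbJ_component wedge_dz_component wedge_dzb_component)

text \<open>Moving \<open>dzb r\<close> past the holomorphic factors costs a sign for each of them,
  and the two sides count these over \<open>K\<close> and over \<open>K - {j}\<close>.\<close>

lemma dzb_wedge_dz_wedge: "dzb r \<and>\<^sub>w dz j \<and>\<^sub>w v = - (dz j \<and>\<^sub>w dzb r \<and>\<^sub>w v)"
proof -
  have "(dzb r \<and>\<^sub>w dz j \<and>\<^sub>w v) $ (K, L) = (- (dz j \<and>\<^sub>w dzb r \<and>\<^sub>w v)) $ (K, L)" for K L
  proof (cases "j \<in> K")
    case True
    then have "card K = Suc (card (K - {j}))"
      using card.remove[of K j] by simp
    then have "(- 1) ^ card K = - ((- 1) ^ card (K - {j}) :: complex)"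
      by (metis mult_minus1 power_Suc)
    with True show ?thesis
      by (simp add: wedge_dz_component wedge_dzb_component)
  qed (simp add: wedge_dz_component wedge_dzb_component)
  then show ?thesis
    by (auto simp: vec_eq_iff)
qed


section \<open>Derivatives of forms\<close>

lemma ddz_has_derivative:
  "(f has_derivative D) (at z) \<Longrightarrow> ddz k f z = (D (axis k 1) - \<i> * D (axis k \<i>)) / 2"
  by (simp add: ddz_def flip: frechet_derivative_at)

lemma del_fun_const: "del_fun (\<lambda>w. a) z = 0"
  by (simp add: del_fun_def ddz_has_derivative[OF has_derivative_const])

lemma ddz_form_component: "ddz_form k u z $ (I, J) = ddz k (\<lambda>w. u w $ (I, J)) z"
proof -
  have "ddz_form k u z $ (I, J) = (\<Sum>I'\<in>UNIV. \<Sum>J'\<in>UNIV.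
      if I' = I then if J' = J then ddz k (\<lambda>w. u w $ (I, J)) z else 0 else 0)"
    unfolding ddz_form_def sum_component vector_smult_component
    by (intro sum.cong refl) (auto simp: dzI_dzbJ_def axis_def)
  also have "\<dots> = (\<Sum>I'\<in>UNIV. if I' = I then ddz k (\<lambda>w. u w $ (I, J)) z else 0)"
    by (intro sum.cong refl) (auto simp: sum.delta)
  finally show ?thesis
    by simp
qed

text \<open>Expressing \<open>ddz_form\<close> through the full derivative of \<open>u\<close>,
  instead of its coefficients, lets linear operators on forms be applied directly.\<close>

lemma ddz_form_has_derivative:
  assumes "(u has_derivative D) (at z)"
  shows "ddz_form k u z = (1 / 2) *s (D (axis k 1) - \<i> *s D (axis k \<i>))"
proof -
  have "((\<lambda>w. u w $ i) has_derivative (\<lambda>h. D h $ i)) (at z)" for i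
    by (rule bounded_linear.has_derivative[OF bounded_linear_vec_nth assms])
  note this [THEN ddz_has_derivative]
  then show ?thesis
    by (simp add: vec_eq_iff ddz_form_component diff_divide_distrib)
qed

text \<open>Each \<open>T m\<close> is a fixed linear map, hence commutes with real derivatives;
  complex linearity carries it past the factor \<i> in \<open>ddz_form\<close>. The index set is
  left abstract to serve for single indices k and for pairs (k, r).\<close>

lemma ddz_form_sum_smult:
  fixes u :: "'n cvec \<Rightarrow> 'n::{finite,linorder} form"
  assumes "finite M"
    and "\<And>m. m \<in> M \<Longrightarrow> f m differentiable (at z)"
    and "u differentiable (at z)"
    and T: "\<And>m. m \<in> M \<Longrightarrow> clinear (T m)"
  shows "ddz_form j (\<lambda>w. \<Sum>m\<in>M. f m w *s T m (u w)) z =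
    (\<Sum>m\<in>M. ddz j (f m) z *s T m (u z)) + (\<Sum>m\<in>M. f m z *s T m (ddz_form j u z))"
proof -
  obtain U where U: "(u has_derivative U) (at z)"
    using assms(3) by (auto simp: differentiable_def)
  obtain F where F: "(f m has_derivative F m) (at z)" if "m \<in> M" for m
    using assms(2) unfolding differentiable_def by metis
  have *: "((\<lambda>w. \<Sum>m\<in>M. f m w *s T m (u w)) has_derivative
      (\<lambda>h. \<Sum>m\<in>M. f m z *s T m (U h) + F m h *s T m (u z))) (at z)"
    by (intro has_derivative_sum bounded_bilinear.FDERIV[OF bounded_bilinear_smult] F
        bounded_linear.has_derivative[OF clinear_imp_bounded_linear[OF T] U])
  have "ddz_form j (\<lambda>w. \<Sum>m\<in>M. f m w *s T m (u w)) z =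
      (\<Sum>m\<in>M. ((F m (axis j 1) - \<i> * F m (axis j \<i>)) / 2) *s T m (u z)
        + f m z *s ((1 / 2) *s (T m (U (axis j 1)) - \<i> *s T m (U (axis j \<i>)))))"
    unfolding ddz_form_has_derivative[OF *]
    by (auto simp: vec_eq_iff field_simps sum_distrib_left sum_divide_distrib
        simp flip: sum_subtractf sum.distrib intro!: sum.cong)
  also have "\<dots> = (\<Sum>m\<in>M. ddz j (f m) z *s T m (u z) + f m z *s T m (ddz_form j u z))"
    using T by (intro sum.cong refl)
      (simp add: ddz_has_derivative[OF F] ddz_form_has_derivative[OF U] clinear_scale clinear_diff)
  finally show ?thesis
    by (simp add: sum.distrib)
qed

text \<open>Regrouping the coefficientwise definition by the direction of differentiation exposes
  the factor \<open>dz k\<close>, to which the commutation rules apply.\<close>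

lemma del_eq_sum_dz_wedge: "del u z = (\<Sum>k\<in>UNIV. dz k \<and>\<^sub>w ddz_form k u z)"
proof -
  have "del u z = (\<Sum>I\<in>UNIV. \<Sum>J\<in>UNIV. \<Sum>k\<in>UNIV.
      dz k \<and>\<^sub>w (ddz k (\<lambda>w. u w $ (I, J)) z *s dzI_dzbJ I J))"
    by (simp add: del_def del_fun_def clinear_sum[OF clinear_wedge_left]
        clinear_scale[OF clinear_wedge_left] clinear_scale[OF clinear_wedge_right])
  also have "\<dots> = (\<Sum>k\<in>UNIV. \<Sum>I\<in>UNIV. \<Sum>J\<in>UNIV.
      dz k \<and>\<^sub>w (ddz k (\<lambda>w. u w $ (I, J)) z *s dzI_dzbJ I J))"
    by (subst sum.swap[of _ _ "UNIV :: 'a set"], subst sum.swap) (rule refl)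
  finally show ?thesis
    by (simp add: ddz_form_def clinear_sum[OF clinear_wedge_right])
qed

text \<open>Local expressions of \<xi> and \<theta> hold only on the coordinate range;
  \<open>del\<close> at a point sees only the germ there.\<close>

lemma del_cong:
  assumes "open S" "z \<in> S" "\<And>w. w \<in> S \<Longrightarrow> u w = v w"
  shows "del u z = del v z"
proof -
  \<comment> \<open>\<open>frechet_derivative\<close> is a choice among all derivatives, so equal
    sets of candidates give equal values even where no derivative exists.\<close>
  have "frechet_derivative (\<lambda>w. u w $ i) (at z) = frechet_derivative (\<lambda>w. v w $ i) (at z)" for i
  proof -
    have "((\<lambda>w. u w $ i) has_derivative D) (at z) \<longleftrightarrow> ((\<lambda>w. v w $ i) has_derivative D) (at z)" for D
      using assms by (auto intro: has_derivative_transform_within_open)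
    then show ?thesis by (simp add: frechet_derivative_def)
  qed
  then show ?thesis by (simp add: del_def del_fun_def ddz_def)
qed

text \<open>The operators \<open>T m\<close> are kept inside \<open>dz j\<close>: how they move past
  it is where the two Lie derivatives differ.\<close>

lemma del_sum_smult:
  fixes u :: "'n cvec \<Rightarrow> 'n::{finite,linorder} form"
  assumes "finite M"
    and "\<And>m. m \<in> M \<Longrightarrow> f m differentiable (at z)"
    and "u differentiable (at z)"
    and "\<And>m. m \<in> M \<Longrightarrow> clinear (T m)"
  shows "del (\<lambda>w. \<Sum>m\<in>M. f m w *s T m (u w)) z =
    (\<Sum>m\<in>M. del_fun (f m) z \<and>\<^sub>w T m (u z)) +
    (\<Sum>m\<in>M. f m z *s (\<Sum>j\<in>UNIV. dz j \<and>\<^sub>w T m (ddz_form j u z)))"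
proof -
  have "ddz_form j (\<lambda>w. \<Sum>m\<in>M. f m w *s T m (u w)) z =
      (\<Sum>m\<in>M. ddz j (f m) z *s T m (u z)) + (\<Sum>m\<in>M. f m z *s T m (ddz_form j u z))" for j
    by (rule ddz_form_sum_smult) (use assms in auto)
  then show ?thesis
    by (simp add: del_eq_sum_dz_wedge del_fun_def clinear_add[OF clinear_wedge_right]
        clinear_sum[OF clinear_wedge_right] clinear_scale[OF clinear_wedge_right]
        clinear_sum[OF clinear_wedge_left] clinear_scale[OF clinear_wedge_left]
        sum.distrib sum.swap[of _ M UNIV] flip: sum_cmul)
qed


section \<open>Lie derivatives in coordinates\<close>

lemma tensor_ddz_component: "tensor_ddz \<alpha> k $ j = (if j = k then \<alpha> else 0)"
  by (simp add: tensor_ddz_def axis_def)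

lemma sum_tensor_ddz_component: "(\<Sum>k\<in>UNIV. tensor_ddz (\<alpha> k) k) $ k = \<alpha> k"
  by (simp add: tensor_ddz_component)

lemma contraction_sum_tensor_ddz:
  "contraction (\<Sum>k\<in>UNIV. tensor_ddz (\<alpha> k) k) v = (\<Sum>k\<in>UNIV. \<alpha> k \<and>\<^sub>w contr k v)"
  by (simp add: contraction_def sum_tensor_ddz_component del: sum_component)

lemma sum_tensor_ddz: "(\<Sum>r\<in>R. tensor_ddz (\<alpha> r) k) = tensor_ddz (\<Sum>r\<in>R. \<alpha> r) k"
  by (subst vec_eq_iff) (simp add: tensor_ddz_component)

text \<open>Like \<open>sum_smult_dzb_component\<close>, this recovers a coefficient function from
  the tensor, whose components are known to be smooth.\<close>

lemma scalar_form_component: "scalar_form a $ ({}, {}) = a"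
  by (simp add: scalar_form_def dzI_dzbJ_def)

lemma sum_smult_dzb_component: "(\<Sum>r\<in>UNIV. a r *s dzb r) $ ({}, {r}) = a r"
  by (simp add: dzb_def dzI_dzbJ_def axis_def if_distrib[of "(*) _"] cong: if_cong)

lemma contr_del:
  "contr k (del u z) = ddz_form k u z - (\<Sum>j\<in>UNIV. dz j \<and>\<^sub>w contr k (ddz_form j u z))"
  by (simp add: del_eq_sum_dz_wedge clinear_sum[OF clinear_contr] contr_dz_wedge sum_subtractf)

text \<open>The minus sign in \<open>contr_del\<close> and the one from anticommuting
  \<open>dzb r\<close> with \<open>dz j\<close> combine to a plus, which the subtraction in
  \<open>Lie01\<close> cancels.\<close>

lemma dzb_wedge_contr_del:
  "dzb r \<and>\<^sub>w contr k (del u z) =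
     dzb r \<and>\<^sub>w ddz_form k u z + (\<Sum>j\<in>UNIV. dz j \<and>\<^sub>w dzb r \<and>\<^sub>w contr k (ddz_form j u z))"
  by (simp add: contr_del clinear_diff[OF clinear_wedge_right] clinear_sum[OF clinear_wedge_right]
      dzb_wedge_dz_wedge sum_negf)

text \<open>Only a local expression near \<open>z\<close> is required, not membership in
  \<open>t_forms\<close>, so that the locally defined \<open>coord_field\<close> is covered as
  well.\<close>

lemma Lie10_in_coordinates:
  assumes S: "open S" "z \<in> S"
    and \<xi>: "\<And>w. w \<in> S \<Longrightarrow> \<xi> c w = (\<Sum>k\<in>UNIV. tensor_ddz (scalar_form (f k w)) k)"
    and f: "\<And>k. f k differentiable (at z)"
    and u: "u c differentiable (at z)"
  shows "Lie10 \<xi> u c z = (\<Sum>k\<in>UNIV. del_fun (f k) z \<and>\<^sub>w contr k (u c z))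
      + (\<Sum>k\<in>UNIV. f k z *s ddz_form k (u c) z)"
proof -
  have \<xi>': "contraction (\<xi> c w) v = (\<Sum>k\<in>UNIV. f k w *s contr k v)" if "w \<in> S" for w v
    by (simp add: \<xi> that contraction_sum_tensor_ddz wedge_scalar_form)
  have "del (\<lambda>w. contraction (\<xi> c w) (u c w)) z
      = del (\<lambda>w. \<Sum>k\<in>UNIV. f k w *s contr k (u c w)) z"
    by (rule del_cong[OF S]) (rule \<xi>')
  also have "\<dots> = (\<Sum>k\<in>UNIV. del_fun (f k) z \<and>\<^sub>w contr k (u c z)) +
      (\<Sum>k\<in>UNIV. f k z *s (\<Sum>j\<in>UNIV. dz j \<and>\<^sub>w contr k (ddz_form j (u c) z)))"
    by (rule del_sum_smult) (simp_all add: f u clinear_contr)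
  finally show ?thesis
    by (simp add: Lie10_def del_X_def contraction_X_def \<xi>' S contr_del
        vector_ssub_ldistrib sum_subtractf)
qed

lemma Lie01_in_coordinates:
  fixes g :: "'n::{finite,linorder} \<Rightarrow> 'n \<Rightarrow> 'n cvec \<Rightarrow> complex"
    and u :: "('a, 'n) chart \<Rightarrow> 'n cvec \<Rightarrow> 'n form"
  assumes S: "open S" "z \<in> S"
    and \<theta>: "\<And>w. w \<in> S \<Longrightarrow> \<theta> c w = (\<Sum>k\<in>UNIV. \<Sum>r\<in>UNIV. tensor_ddz (g k r w *s dzb r) k)"
    and g: "\<And>k r. g k r differentiable (at z)"
    and u: "u c differentiable (at z)"
  shows "Lie01 \<theta> u c z = (\<Sum>k\<in>UNIV. \<Sum>r\<in>UNIV. del_fun (g k r) z \<and>\<^sub>w dzb r \<and>\<^sub>w contr k (u c z))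
      - (\<Sum>k\<in>UNIV. \<Sum>r\<in>UNIV. g k r z *s (dzb r \<and>\<^sub>w ddz_form k (u c) z))"
proof -
  \<comment> \<open>The double sum over k and r is treated as one sum over pairs, which makes
    \<open>del_sum_smult\<close> applicable as it stands.\<close>
  let ?T = "\<lambda>m v. dzb (snd m) \<and>\<^sub>w contr (fst m) v"
  let ?g = "\<lambda>m. g (fst m) (snd m)"
  have \<theta>': "contraction (\<theta> c w) v = (\<Sum>m\<in>UNIV. ?g m w *s ?T m v)" if "w \<in> S" for w v
    by (simp add: \<theta> that sum_tensor_ddz contraction_sum_tensor_ddz clinear_sum[OF clinear_wedge_left]
        clinear_scale[OF clinear_wedge_left] sum.cartesian_product split_def)
  have T: "clinear (?T m)" for m :: "'n \<times> 'n"
    using Vector_Spaces.linear_compose[OF clinear_contr clinear_wedge_right] by (simp add: o_def)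
  have "del (\<lambda>w. contraction (\<theta> c w) (u c w)) z
      = del (\<lambda>w. \<Sum>m\<in>UNIV. ?g m w *s ?T m (u c w)) z"
    by (rule del_cong[OF S]) (rule \<theta>')
  also have "\<dots> = (\<Sum>m\<in>UNIV. del_fun (?g m) z \<and>\<^sub>w ?T m (u c z)) +
      (\<Sum>m\<in>UNIV. ?g m z *s (\<Sum>j\<in>UNIV. dz j \<and>\<^sub>w ?T m (ddz_form j (u c) z)))"
    by (rule del_sum_smult) (simp_all add: g u T)
  finally show ?thesis
    by (simp add: Lie01_def del_X_def contraction_X_def \<theta>' S dzb_wedge_contr_del
        vector_add_ldistrib sum.distrib sum.cartesian_product split_def)
qed

lemma contraction_del_vec:
  "contraction (del_vec f z) v = (\<Sum>k\<in>UNIV. del_fun (f k) z \<and>\<^sub>w contr k v)"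
  by (simp add: del_vec_def contraction_sum_tensor_ddz)

lemma contraction_del_t01:
  "contraction (del_t01 g z) v = (\<Sum>k\<in>UNIV. \<Sum>r\<in>UNIV. del_fun (g k r) z \<and>\<^sub>w dzb r \<and>\<^sub>w contr k v)"
  by (simp add: del_t01_def sum_tensor_ddz contraction_sum_tensor_ddz del_fun_def
      clinear_sum[OF clinear_wedge_left] clinear_scale[OF clinear_wedge_left] dz_wedge_dzb_wedge)

section \<open>Passage from the manifold to a chart\<close>

lemma smooth_on_imp_differentiable:
  assumes "smooth_on S f" "z \<in> S"
  shows "f differentiable (at z)"
  using assms Ck_on.simps(2)[of 0 S f] unfolding smooth_on_def by blast

lemma differentiable_transform_open:
  assumes "f differentiable (at z)" "open S" "z \<in> S" "\<And>w. w \<in> S \<Longrightarrow> f w = g w"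
  shows "g differentiable (at z)"
  using assms has_derivative_transform_within_open unfolding differentiable_def by metis

lemma transition_self:
  assumes "is_chart X c" "z \<in> coord_range c"
  shows "transition c c z = z"
  using assms by (auto simp: transition_def coord_range_def f_inv_into_f)

text \<open>The transition map of a chart to itself is the identity on the open coordinate range, so
  its Jacobian there is the identity matrix.\<close>

lemma coord_field_self:
  assumes "is_chart X c" "z \<in> coord_range c"
  shows "coord_field c k c z = (\<Sum>j\<in>UNIV. tensor_ddz (scalar_form (if j = k then 1 else 0)) j)"
proof -
  have S: "open (coord_range c)" using assms by (simp add: is_chart_def)
  have D: "((\<lambda>w. transition c c w $ j) has_derivative (\<lambda>h. h $ j)) (at z)" for j
    by (rule has_derivative_transform_within_open[OF _ S assms(2)])
      (auto simp: transition_self[OF assms(1)] bounded_linear_vec_nth intro: bounded_linear_imp_has_derivative)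
  have "ddz k (\<lambda>w. transition c c w $ j) z = (if j = k then 1 else 0)" for j
    using ddz_has_derivative[OF D[of j], of k] by (cases "j = k") (simp_all add: axis_def)
  then show ?thesis
    by (simp add: coord_field_def transition_self[OF assms])
qed

lemma pq_forms_differentiable:
  assumes "u \<in> pq_forms A p q" "c \<in> A" "z \<in> coord_range c"
  shows "u c differentiable (at z)"
proof (rule differentiable_vec_componentwise)
  show "(\<lambda>w. u c w $ i) differentiable (at z)" for i
    using assms by (cases i) (auto simp: pq_forms_def intro: smooth_on_imp_differentiable)
qed

lemma t_forms_component_differentiable:
  assumes "\<alpha> \<in> t_forms A s" "c \<in> A" "z \<in> coord_range c"
  shows "(\<lambda>w. \<alpha> c w $ k $ (I, J)) differentiable (at z)"
proof -
  have "smooth_on (coord_range c) (\<lambda>w. \<alpha> c w $ k $ (I, J))"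
    using assms(1,2) unfolding t_forms_def by blast
  then show ?thesis
    using assms(3) by (rule smooth_on_imp_differentiable)
qed

theorem proposition4p3:
  fixes X :: "'a topology"
    and A :: "('a, 'n::{finite,linorder}) chart set"
  assumes "complex_manifold X A"
  shows
    "(\<forall>\<xi>\<in>t_forms A 0. \<forall>c\<in>A. \<forall>f :: 'n \<Rightarrow> 'n cvec \<Rightarrow> complex.
        (\<forall>z\<in>coord_range c. \<xi> c z = (\<Sum>k\<in>UNIV. tensor_ddz (scalar_form (f k z)) k)) \<longrightarrow>
        (\<forall>p q. \<forall>u\<in>pq_forms A p q. \<forall>z\<in>coord_range c.
          Lie10 \<xi> u c z =
            (\<Sum>k\<in>UNIV. del_fun (f k) z \<and>\<^sub>w contr k (u c z))
            + (\<Sum>k\<in>UNIV. f k z *s ddz_form k (u c) z) \<and>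
          Lie10 \<xi> u c z = contraction (del_vec f z) (u c z) + act_vec f (u c) z)) \<and>
     (\<forall>c\<in>A. \<forall>p q. \<forall>u\<in>pq_forms A p q. \<forall>k. \<forall>z\<in>coord_range c.
        Lie10 (coord_field c k) u c z = ddz_form k (u c) z) \<and>
     (\<forall>\<theta>\<in>t_forms A 1. \<forall>c\<in>A. \<forall>g :: 'n \<Rightarrow> 'n \<Rightarrow> 'n cvec \<Rightarrow> complex.
        (\<forall>z\<in>coord_range c. \<theta> c z =
           (\<Sum>k\<in>UNIV. \<Sum>r\<in>UNIV. tensor_ddz (g k r z *s dzb r) k)) \<longrightarrow>
        (\<forall>p q. \<forall>u\<in>pq_forms A p q. \<forall>z\<in>coord_range c.
          Lie01 \<theta> u c z =
            (\<Sum>k\<in>UNIV. \<Sum>r\<in>UNIV. del_fun (g k r) z \<and>\<^sub>w dzb r \<and>\<^sub>w contr k (u c z))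
            - (\<Sum>k\<in>UNIV. \<Sum>r\<in>UNIV. g k r z *s (dzb r \<and>\<^sub>w ddz_form k (u c) z)) \<and>
          Lie01 \<theta> u c z = contraction (del_t01 g z) (u c z) - act_t01 g (u c) z))"
proof -
  have chart: "is_chart X c" and op: "open (coord_range c)" if "c \<in> A" for c
    using assms that by (auto simp: complex_manifold_def is_chart_def)
  have 1: "Lie10 \<xi> u c z = (\<Sum>k\<in>UNIV. del_fun (f k) z \<and>\<^sub>w contr k (u c z))
      + (\<Sum>k\<in>UNIV. f k z *s ddz_form k (u c) z)"
    if \<xi>: "\<xi> \<in> t_forms A 0" and c: "c \<in> A" and u: "u \<in> pq_forms A p q" and z: "z \<in> coord_range c"
      and eq: "\<forall>z\<in>coord_range c. \<xi> c z = (\<Sum>k\<in>UNIV. tensor_ddz (scalar_form (f k z)) k)"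
    for \<xi> c f p q u z
  proof (rule Lie10_in_coordinates[where u = u and c = c and S = "coord_range c"])
    \<comment> \<open>Nothing is assumed about \<open>f\<close> outside the coordinate range. On
      that open set it agrees with a smooth component of \<xi>, which suffices at
      \<open>z\<close>.\<close>
    show "f k differentiable (at z)" for k
      by (rule differentiable_transform_open[OF t_forms_component_differentiable[OF \<xi> c z, of k "{}" "{}"]
          op[OF c] z])
        (simp only: eq[rule_format] sum_tensor_ddz_component scalar_form_component)
  qed (use op[OF c] z eq pq_forms_differentiable[OF u c z] in auto)
  have 2: "Lie10 (coord_field c k) u c z = ddz_form k (u c) z"
    if c: "c \<in> A" and u: "u \<in> pq_forms A p q" and z: "z \<in> coord_range c" for c p q u k z
  proof -
    \<comment> \<open>The coefficients are the constants 0 and 1, so the sum containing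
      \<open>del_fun\<close> vanishes and the other reduces to the term
      \<open>j = k\<close>.\<close>
    have "Lie10 (coord_field c k) u c z =
        (\<Sum>j\<in>UNIV. del_fun (\<lambda>w. if j = k then 1 else 0) z \<and>\<^sub>w contr j (u c z))
        + (\<Sum>j\<in>UNIV. (if j = k then 1 else 0) *s ddz_form j (u c) z)"
      by (rule Lie10_in_coordinates[where u = u and c = c and S = "coord_range c"])
        (use op[OF c] z coord_field_self[OF chart[OF c]] pq_forms_differentiable[OF u c z] in auto)
    also have "\<dots> = (\<Sum>j\<in>UNIV. if j = k then ddz_form j (u c) z else 0)"
      by (simp add: del_fun_const vec.linear_0[OF clinear_wedge_left] if_distrib[of "\<lambda>a. a *s _"]
          cong: if_cong)
    finally show ?thesis
      by simp
  qed
  have 3: "Lie01 \<theta> u c z = (\<Sum>k\<in>UNIV. \<Sum>r\<in>UNIV. del_fun (g k r) z \<and>\<^sub>w dzb r \<and>\<^sub>w contr k (u c z))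
      - (\<Sum>k\<in>UNIV. \<Sum>r\<in>UNIV. g k r z *s (dzb r \<and>\<^sub>w ddz_form k (u c) z))"
    if \<theta>: "\<theta> \<in> t_forms A 1" and c: "c \<in> A" and u: "u \<in> pq_forms A p q" and z: "z \<in> coord_range c"
      and eq: "\<forall>z\<in>coord_range c. \<theta> c z =
        (\<Sum>k\<in>UNIV. \<Sum>r\<in>UNIV. tensor_ddz (g k r z *s dzb r) k)"
    for \<theta> c g p q u z
  proof (rule Lie01_in_coordinates[where u = u and c = c and S = "coord_range c"])
    \<comment> \<open>As for \<open>f\<close>, now with the coefficient of \<open>dzb r\<close> in
      the component \<open>k\<close> of \<theta>.\<close>
    show "g k r differentiable (at z)" for k r
      by (rule differentiable_transform_open[OF t_forms_component_differentiable[OF \<theta> c z, of k "{}" "{r}"]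
          op[OF c] z])
        (simp only: eq[rule_format] sum_tensor_ddz sum_tensor_ddz_component sum_smult_dzb_component)
  qed (use op[OF c] z eq pq_forms_differentiable[OF u c z] in auto)
  show ?thesis
    unfolding contraction_del_vec contraction_del_t01 act_vec_def act_t01_def
    by (intro conjI ballI allI impI; (rule 1 | rule 2 | rule 3); assumption)
qed

end
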